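(* Let $E$ be a (Hausdorff) topological vector space over $\mathbb{F}$, with the operation of scalar multiplication given by $\mu:\mathbb{F}\times E\to E$, and let $K\subset E$ contain no pairs of linearly dependent elements. Then: (i) If $K$ is compact, then $\mu|_{\mathbb{F}^{\times}\times K}$ is a topological embedding and $\mu|_{\mathbb{F}\times K}$ is a quotient map onto its image $\mathbb{F}K$. (ii) Let $B\subset\mathbb{F}^{\times}$ be bounded. If $K\cup\{0_{E}\}$ is compact, then $\mu|_{B\times K}$ is a topological embedding.
   Context: $\mathbb{F}$ is $\mathbb{R}$ or $\mathbb{C}$, $\mathbb{F}^{\times}=\mathbb{F}\setminus\{0\}$, $\mu(a,e)=ae$, and $\mathbb{F}K=\{ae: a\in\mathbb{F},\ e\in K\}$ carries the subspace topology from $E$. "$K$ contains no pairs of linearly dependent elements" means that $0_E\notin K$ and any two distinct elements of $K$ are linearly independent. A topological embedding is a homeomorphism onto its image. *)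

theory Defs
  imports "HOL-Analysis.Analysis"
begin

text \<open>
  Scalar multiplication is an explicit parameter, since the library has no type class of complex
  vector spaces. Continuity of addition is part of the sort \<open>topological_ab_group_add\<close>;
  continuity of negation, also part of that sort, holds in every topological vector space
  because negation is scaling by -1. The Hausdorff property is the sort \<open>t2_space\<close>.
\<close>

locale topological_vector_space = vector_space scale
  for scale :: "'f::real_normed_field \<Rightarrow> 'e::{topological_ab_group_add, t2_space} \<Rightarrow> 'e" +
  assumes continuous_on_scale: "continuous_on UNIV (\<lambda>(a, e). scale a e)"

definition (in vector_space) no_dependent_pairs :: "'b set \<Rightarrow> bool" where
  "no_dependent_pairs K \<longleftrightarrow>
     0 \<notin> K \<and> (\<forall>x\<in>K. \<forall>y\<in>K. x \<noteq> y \<longrightarrow> independent {x, y})"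

end

theory Submission
  imports Defs
begin

text \<open>
  Multiplication is injective on pairs with nonzero scalar and vector in \<open>K\<close>, and such products
  have no further preimages with vanishing scalar or vector. Both embeddings are therefore
  restrictions, to a saturated set, of a closed map on a larger set: in (ii) of multiplication on
  a compact \<open>D \<times> (K \<union> {0})\<close>, in (i) of multiplication on the whole of \<open>\<F> \<times> K\<close>.
  The latter is closed because scalars cannot escape to infinity: if \<open>a e\<close> stays near \<open>y\<close> while
  \<open>a\<close> is large, then \<open>e = (1/a) (a e)\<close> is near \<open>0 y = 0\<close>, which lies outside the
  closed set \<open>K\<close>.
\<close>

lemma saturated_restriction_embedding_map:
  assumes "continuous_map X Y f" "closed_map X Y f" "inj_on f U"
    and sat: "{x \<in> topspace X. f x \<in> f ` U} = U"
  shows "embedding_map (subtopology X U) Y f"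
proof -
  have "closed_map (subtopology X U) (subtopology Y (f ` U)) f"
    using assms(2) sat by (rule closed_map_restriction)
  moreover have "continuous_map (subtopology X U) (subtopology Y (f ` U)) f"
    using assms(1) by (auto simp: continuous_map_in_subtopology continuous_map_from_subtopology)
  ultimately have "embedding_map (subtopology X U) (subtopology Y (f ` U)) f"
    using assms(3) by (intro injective_closed_imp_embedding_map) (auto intro: inj_on_subset)
  then show ?thesis
    by (simp add: embedding_map_in_subtopology)
qed

context topological_vector_space
begin

lemma inj_on_scale:
  assumes "no_dependent_pairs K"
  shows "inj_on (\<lambda>(a, e). scale a e) ((UNIV - {0}) \<times> K)"
proof (clarsimp simp: inj_on_def)
  fix a x b y
  assume *: "a \<noteq> 0" "x \<in> K" "b \<noteq> 0" "y \<in> K" "scale a x = scale b y"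
  have "x = y"
  proof (rule ccontr)
    assume "x \<noteq> y"
    then have "independent {x, y}"
      using assms * by (auto simp: no_dependent_pairs_def)
    moreover have "x = scale (inverse a * b) y"
      using * by (metis scale_scale scale_one left_inverse)
    then have "x \<in> span ({x, y} - {x})"
      using \<open>x \<noteq> y\<close> by (metis insert_Diff_if singletonD span_base span_scale insert_iff Diff_iff)
    ultimately show False
      by (auto simp: dependent_def)
  qed
  moreover have "x \<noteq> 0"
    using assms * by (auto simp: no_dependent_pairs_def)
  ultimately show "a = b \<and> x = y"
    using * by simp
qed

lemma scale_away_from_closed:
  assumes "closed K" "0 \<notin> K"
  obtains N r where "open N" "y \<in> N" "\<And>a e. e \<in> K \<Longrightarrow> scale a e \<in> N \<Longrightarrow> norm a \<le> r"
proof -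
  \<comment> \<open>Continuity is used at \<open>(0, y)\<close>: a whole box
    \<open>A \<times> N\<close> around this point is mapped off \<open>K\<close>.\<close>
  have "open ((\<lambda>(a, e). scale a e) -` (- K))"
    using continuous_on_scale assms(1) by (intro open_vimage) auto
  moreover have "(0, y) \<in> (\<lambda>(a, e). scale a e) -` (- K)"
    using assms(2) by simp
  ultimately obtain A N where AN: "open A" "open N" "0 \<in> A" "y \<in> N"
    and sub: "A \<times> N \<subseteq> (\<lambda>(a, e). scale a e) -` (- K)"
    by (rule open_prod_elim) auto
  obtain d where d: "d > 0" "ball 0 d \<subseteq> A"
    using AN open_contains_ball by blast
  show ?thesis
  proof
    fix a e
    assume e: "e \<in> K" "scale a e \<in> N"
    \<comment> \<open>Rescaling \<open>scale a e\<close> by \<open>inverse a\<close> returns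
      \<open>e\<close>, a point of \<open>K\<close>. So \<open>inverse a\<close> lies outside
      \<open>A\<close>, hence outside the ball of radius \<open>d\<close>.\<close>
    show "norm a \<le> 1 / d"
    proof (cases "a = 0")
      case False
      then have "scale (inverse a) (scale a e) \<in> K"
        using e by simp
      then have "inverse a \<notin> ball 0 d"
        using sub e(2) d by fastforce
      then have "d \<le> inverse (norm a)"
        using False by (simp add: norm_inverse not_less)
      then show ?thesis
        using False d by (simp add: field_simps)
    qed (use d in simp)
  qed (use AN in auto)
qed

end

text \<open>Compactness of closed bounded sets of scalars is the property shared by
  \<open>real\<close> and \<open>complex\<close> on which both parts rest.\<close>

locale heine_borel_topological_vector_space = topological_vector_space scale
  for scale :: "'f::{real_normed_field, heine_borel} \<Rightarrow> 'e::{topological_ab_group_add, t2_space} \<Rightarrow> 'e"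
begin

lemma closed_map_scale:
  assumes "compact K" "0 \<notin> K"
  shows "closed_map (top_of_set (UNIV \<times> K)) euclidean (\<lambda>(a, e). scale a e)"
proof (unfold closed_map_def, intro allI impI)
  let ?m = "\<lambda>(a, e). scale a e"
  fix C :: "('f \<times> 'e) set"
  assume "closedin (top_of_set (UNIV \<times> K)) C"
  moreover have "closed K"
    using assms(1) by (rule compact_imp_closed)
  ultimately have C: "closed C" "C \<subseteq> UNIV \<times> K"
    by (auto intro: closedin_closed_trans closed_Times simp: closedin_imp_subset)
  \<comment> \<open>Closedness is checked near one \<open>y\<close> at a time: inside
    \<open>N\<close> only scalars of norm at most \<open>r\<close> contribute, so there the image of
    \<open>C\<close> agrees with that of its compact part \<open>?D\<close>.\<close>
  have "y \<in> ?m ` C" if y: "y \<in> closure (?m ` C)" for y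
  proof -
    obtain N r where N: "open N" "y \<in> N" "\<And>a e. e \<in> K \<Longrightarrow> scale a e \<in> N \<Longrightarrow> norm a \<le> r"
      using scale_away_from_closed[OF \<open>closed K\<close> assms(2)] by blast
    let ?D = "C \<inter> cball 0 r \<times> K"
    have "compact ?D"
      using C assms(1) by (intro closed_Int_compact compact_Times) auto
    then have "closed (?m ` ?D)"
      by (intro compact_imp_closed compact_continuous_image continuous_on_subset[OF continuous_on_scale]) auto
    have "N \<inter> ?m ` C \<subseteq> ?m ` ?D"
      using N(3) C by force
    moreover have "y \<in> closure (N \<inter> ?m ` C)"
      using open_Int_closure_subset[OF N(1), of "?m ` C"] N(2) y by blast
    ultimately have "y \<in> ?m ` ?D"
      using \<open>closed (?m ` ?D)\<close> by (meson closure_minimal subsetD)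
    then show ?thesis by blast
  qed
  then have "closed (?m ` C)"
    by (simp add: closure_subset_eq[symmetric] subsetI)
  then show "closedin euclidean (?m ` C)"
    by simp
qed

text \<open>The bounds on \<open>L\<close> admit both \<open>K\<close> and
  \<open>insert 0 K\<close>, so that one argument serves both embeddings.\<close>

lemma embedding_map_scale:
  assumes K: "no_dependent_pairs K" and "0 \<notin> B" "B \<subseteq> A" "K \<subseteq> L" "L \<subseteq> insert 0 K"
    and closed: "closed_map (top_of_set (A \<times> L)) euclidean (\<lambda>(a, e). scale a e)"
  shows "embedding_map (top_of_set (B \<times> K)) euclidean (\<lambda>(a, e). scale a e)"
proof -
  let ?m = "\<lambda>(a, e). scale a e"
  have sub: "B \<times> K \<subseteq> A \<times> L"
    using \<open>B \<subseteq> A\<close> \<open>K \<subseteq> L\<close> by blast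
  have "embedding_map (subtopology (top_of_set (A \<times> L)) (B \<times> K)) euclidean ?m"
  proof (rule saturated_restriction_embedding_map)
    show "continuous_map (top_of_set (A \<times> L)) euclidean ?m"
      using continuous_on_subset[OF continuous_on_scale] by auto
    show "inj_on ?m (B \<times> K)"
      using \<open>0 \<notin> B\<close> by (intro inj_on_subset[OF inj_on_scale[OF K]]) auto
    \<comment> \<open>Saturation: products from \<open>B \<times> K\<close> are nonzero, so a
      preimage in \<open>A \<times> L\<close> has nonzero scalar and vector. Its vector then lies in
      \<open>K\<close>, where injectivity applies.\<close>
    have "(a, e) \<in> B \<times> K"
      if "(a, e) \<in> A \<times> L" "(b, k) \<in> B \<times> K" "scale a e = scale b k" for a e b k
    proof -
      have "scale b k \<noteq> 0"
        using that K \<open>0 \<notin> B\<close> by (auto simp: no_dependent_pairs_def)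
      then have "a \<noteq> 0" "e \<noteq> 0"
        using that(3) by auto
      then have "(a, e) \<in> (UNIV - {0}) \<times> K" "(b, k) \<in> (UNIV - {0}) \<times> K"
        using that \<open>0 \<notin> B\<close> \<open>L \<subseteq> insert 0 K\<close> by auto
      then have "(a, e) = (b, k)"
        using that(3) by (intro inj_onD[OF inj_on_scale[OF K]]) auto
      then show ?thesis
        using that(2) by simp
    qed
    then have "p \<in> B \<times> K" if "p \<in> A \<times> L" "?m p \<in> ?m ` (B \<times> K)" for p
      using that by (cases p) (auto simp only: image_iff prod.case)
    then show "{p \<in> topspace (top_of_set (A \<times> L)). ?m p \<in> ?m ` (B \<times> K)} = B \<times> K"
      using sub by (simp only: topspace_euclidean_subtopology) blast
  qed (rule closed)
  then show ?thesis
    using sub by (simp add: subtopology_subtopology Int_absorb1)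
qed

lemma embedding_map_scale_nonzero:
  assumes "no_dependent_pairs K" "compact K"
  shows "embedding_map (top_of_set ((UNIV - {0}) \<times> K)) euclidean (\<lambda>(a, e). scale a e)"
  using assms closed_map_scale[of K]
  by (intro embedding_map_scale[where A = UNIV and L = K]) (auto simp: no_dependent_pairs_def)

text \<open>A continuous closed surjection is a quotient map. The zero scalar now stays in the
  domain and collapses \<open>{0} \<times> K\<close> to the origin, hence a quotient map rather than
  an embedding.\<close>

lemma quotient_map_scale:
  assumes "compact K" "0 \<notin> K"
  shows "quotient_map (top_of_set (UNIV \<times> K)) (top_of_set {scale a e |a e. e \<in> K})
           (\<lambda>(a, e). scale a e)"
proof -
  let ?m = "\<lambda>(a, e). scale a e"
  have img: "?m ` (UNIV \<times> K) = {scale a e |a e. e \<in> K}"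
    by force
  have "continuous_map (top_of_set (UNIV \<times> K)) (top_of_set {scale a e |a e. e \<in> K}) ?m"
    using continuous_on_subset[OF continuous_on_scale] by auto
  moreover have "closed_map (top_of_set (UNIV \<times> K)) (top_of_set {scale a e |a e. e \<in> K}) ?m"
    using closed_map_scale[OF assms] by (rule closed_map_into_subtopology) (auto simp: img)
  moreover have "?m ` topspace (top_of_set (UNIV \<times> K)) = topspace (top_of_set {scale a e |a e. e \<in> K})"
    using img by simp
  ultimately show ?thesis
    by (simp add: continuous_closed_imp_quotient_map)
qed

lemma embedding_map_scale_bounded:
  assumes "no_dependent_pairs K" "compact (insert 0 K)" "bounded B" "0 \<notin> B"
  shows "embedding_map (top_of_set (B \<times> K)) euclidean (\<lambda>(a, e). scale a e)"
proof (rule embedding_map_scale[where A = "closure B" and L = "insert 0 K"])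
  \<comment> \<open>Continuous maps from a compact space to a Hausdorff space are closed. Passing to
    the closure may add the scalar 0, but pairs with a zero entry only have product 0.\<close>
  have "compact (closure B \<times> insert 0 K)"
    using assms by (intro compact_Times) auto
  then show "closed_map (top_of_set (closure B \<times> insert 0 K)) euclidean (\<lambda>(a, e). scale a e)"
    by (auto simp: closed_map_def intro!: compact_imp_closed compact_continuous_image
        intro: closedin_compact continuous_on_subset[OF continuous_on_scale])
qed (use assms closure_subset in auto)

lemma embedding_and_quotient_scale:
  assumes "no_dependent_pairs K"
  shows "(compact K \<longrightarrow>
             embedding_map (top_of_set ((UNIV - {0}) \<times> K)) euclidean (\<lambda>(a, e). scale a e) \<and>
             quotient_map (top_of_set (UNIV \<times> K)) (top_of_set {scale a e |a e. e \<in> K})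
               (\<lambda>(a, e). scale a e)) \<and>
          (\<forall>B. B \<subseteq> UNIV - {0} \<and> bounded B \<and> compact (K \<union> {0}) \<longrightarrow>
             embedding_map (top_of_set (B \<times> K)) euclidean (\<lambda>(a, e). scale a e))"
proof -
  have "0 \<notin> K"
    using assms by (simp add: no_dependent_pairs_def)
  then show ?thesis
    using assms embedding_map_scale_nonzero quotient_map_scale embedding_map_scale_bounded
    by (simp add: subset_Diff_insert)
qed

end

theorem theorem3p7:
  shows "(\<forall>(scale :: real \<Rightarrow> 'e::{topological_ab_group_add, t2_space} \<Rightarrow> 'e) (K :: 'e set).
        topological_vector_space scale \<and> vector_space.no_dependent_pairs scale K \<longrightarrow>
          (compact K \<longrightarrow>
             embedding_map (top_of_set ((UNIV - {0}) \<times> K)) euclidean (\<lambda>(a, e). scale a e) \<and>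
             quotient_map (top_of_set (UNIV \<times> K)) (top_of_set {scale a e |a e. e \<in> K})
               (\<lambda>(a, e). scale a e)) \<and>
          (\<forall>B. B \<subseteq> UNIV - {0} \<and> bounded B \<and> compact (K \<union> {0}) \<longrightarrow>
             embedding_map (top_of_set (B \<times> K)) euclidean (\<lambda>(a, e). scale a e))) \<and>
         (\<forall>(scale :: complex \<Rightarrow> 'e \<Rightarrow> 'e) (K :: 'e set).
        topological_vector_space scale \<and> vector_space.no_dependent_pairs scale K \<longrightarrow>
          (compact K \<longrightarrow>
             embedding_map (top_of_set ((UNIV - {0}) \<times> K)) euclidean (\<lambda>(a, e). scale a e) \<and>
             quotient_map (top_of_set (UNIV \<times> K)) (top_of_set {scale a e |a e. e \<in> K})
               (\<lambda>(a, e). scale a e)) \<and>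
          (\<forall>B. B \<subseteq> UNIV - {0} \<and> bounded B \<and> compact (K \<union> {0}) \<longrightarrow>
             embedding_map (top_of_set (B \<times> K)) euclidean (\<lambda>(a, e). scale a e)))"
  by (intro conjI[of "All _" "All _"]; intro allI impI; elim conjE;
      intro heine_borel_topological_vector_space.embedding_and_quotient_scale
        heine_borel_topological_vector_space.intro)

end
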